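(* Let $u,v\in\mathbb{P}^\ast$ be words over the positive integers. If $u$ and $v$ are strongly Wilf-equivalent, i.e. $A_u(x,y,z)=A_v(x,y,z)$, then $u$ and $v$ are rearrangements of each other, i.e. $|u|=|v|$ and there is a permutation $\pi$ of $\{1,\dots,|u|\}$ with $v=u_{\pi(1)}u_{\pi(2)}\cdots u_{\pi(|u|)}$.
   Context: $\mathbb{P}$ denotes the positive integers and $\mathbb{P}^\ast$ the set of finite words over $\mathbb{P}$. For a word $w=w_1\cdots w_n$, $|w|=n$ is its length and $\|w\|=w_1+\cdots+w_n$ is the sum of its entries. A word $v$ dominates a word $u$ if $|v|=|u|$ and $v_i\ge u_i$ for all $i$. A factor of $w$ dominating $u$ is a contiguous subword $w_jw_{j+1}\cdots w_{j+|u|-1}$ that dominates $u$; factors at different starting positions are counted separately. Define $A_u(x,y,z)=\sum_{w\in\mathbb{P}^\ast} x^{|w|}y^{\|w\|}z^{N_u(w)}$, where $N_u(w)$ is the number of factors of $w$ dominating $u$. Two words $u,v$ are strongly Wilf-equivalent if $A_u(x,y,z)=A_v(x,y,z)$ as formal power series. *)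

theory Defs
  imports
    "HOL-Computational_Algebra.Formal_Power_Series"
    "HOL-Combinatorics.Permutations"
begin

definition pos_words :: "nat list set" where
  "pos_words = lists {1..}"

definition dominates :: "nat list \<Rightarrow> nat list \<Rightarrow> bool" where
  "dominates v u \<longleftrightarrow> length v = length u \<and> (\<forall>i<length u. v ! i \<ge> u ! i)"

text \<open>Starting positions are counted from 0. The empty word is dominated at each of the
  \<open>length w + 1\<close> positions of \<open>w\<close>.\<close>

definition num_dominating :: "nat list \<Rightarrow> nat list \<Rightarrow> nat" where
  "num_dominating u w =
     card {j. j + length u \<le> length w \<and> dominates (take (length u) (drop j w)) u}"

text \<open>The ring of power series in \<open>x\<close>, \<open>y\<close>, \<open>z\<close> is rendered as \<open>\<int>[[z]][[y]][[x]]\<close>, with \<open>x\<close> the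
  outermost variable. The formal sum over all words is taken coefficientwise: the words
  contributing to \<open>x\<^sup>n y\<^sup>m\<close> are those of length \<open>n\<close> and sum \<open>m\<close>, and there are finitely many
  of them because letters are positive (\<open>finite_pos_words\<close> below).\<close>

definition word_gf :: "nat list \<Rightarrow> int fps fps fps" where
  "word_gf u =
     Abs_fps (\<lambda>n. Abs_fps (\<lambda>m.
       \<Sum>w | w \<in> pos_words \<and> length w = n \<and> sum_list w = m. fps_X ^ num_dominating u w))"

definition strongly_wilf_equivalent :: "nat list \<Rightarrow> nat list \<Rightarrow> bool" where
  "strongly_wilf_equivalent u v \<longleftrightarrow> word_gf u = word_gf v"

lemma finite_pos_words: "finite {w \<in> pos_words. length w = n \<and> sum_list w = m}"
proof (rule finite_subset)
  show "{w \<in> pos_words. length w = n \<and> sum_list w = m} \<subseteq> {w. set w \<subseteq> {..m} \<and> length w = n}"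
    using member_le_sum_list by fastforce
  show "finite {w. set w \<subseteq> {..m} \<and> length w = n}"
    by (rule finite_lists_length_eq) simp
qed

lemma word_gf_nth:
  "fps_nth (fps_nth (fps_nth (word_gf u) n) m) k =
     int (card {w \<in> pos_words. length w = n \<and> sum_list w = m \<and> num_dominating u w = k})"
proof -
  let ?S = "{w \<in> pos_words. length w = n \<and> sum_list w = m}"
  have "fps_nth (fps_nth (fps_nth (word_gf u) n) m) k =
      (\<Sum>w\<in>?S. if num_dominating u w = k then 1 else 0)"
    by (simp add: word_gf_def fps_sum_nth fps_X_power_nth eq_commute)
  also have "\<dots> = int (card {w \<in> ?S. num_dominating u w = k})"
    by (subst sum.inter_filter[symmetric, OF finite_pos_words]) simp
  also have "{w \<in> ?S. num_dominating u w = k} =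
      {w \<in> pos_words. length w = n \<and> sum_list w = m \<and> num_dominating u w = k}"
    by auto
  finally show ?thesis .
qed

end

theory Submission
  imports Defs
begin

text \<open>Fix a length \<open>n\<close> and put \<open>z = 1 + t\<close>. Then \<open>z\<close> to the number of occurrences of \<open>u\<close> in \<open>w\<close> is the
  sum of \<open>t\<close> to the \<open>card S\<close> over all sets \<open>S\<close> of occurrences, and the words containing \<open>u\<close> at all
  positions in \<open>S\<close> are those above a pointwise least word, of weight \<open>\<sigma>(S)\<close> say. Cancelling the
  generating function of all words with letters in \<open>\<nat>\<close>, strong Wilf equivalence determines the sum
  of \<open>t\<^bsup>|S|\<^esup> y\<^bsup>\<sigma>(S)\<^esup>\<close> over all sets \<open>S\<close> of positions, hence (differentiate at \<open>y = 1\<close>) also the sum of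
  \<open>t\<^bsup>|S|\<^esup> \<sigma>(S)\<close>. Up to terms shared by \<open>u\<close> and \<open>v\<close>, the latter is minus the sum of \<open>z\<^bsup>e(i,k)\<^esup>\<close> over
  columns \<open>i\<close> and levels \<open>k\<close>, where \<open>e(i,k)\<close> counts the positions at which \<open>u\<close> would not put a letter
  greater than \<open>k\<close> on column \<open>i\<close>. Comparing two consecutive lengths isolates one interior column, where
  \<open>e\<close> is one more than the number of letters of \<open>u\<close> that are at most \<open>k\<close>. This number is monotone in
  \<open>k\<close>, so knowing its values with multiplicity is enough to recover the letters of \<open>u\<close>.\<close>

section \<open>Sums over subsets and words above a bound\<close>

lemma sum_power_card_Pow:
  fixes t :: "'a::comm_ring_1"
  assumes "finite A"
  shows "(\<Sum>S\<in>Pow A. t ^ card S) = (1 + t) ^ card A"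
proof -
  have "(1 + t) ^ card A = (\<Prod>x\<in>A. t + 1)"
    by (simp add: add.commute)
  also have "\<dots> = (\<Sum>S\<in>Pow A. (\<Prod>x\<in>S. t) * (\<Prod>x\<in>A - S. 1))"
    using assms by (rule prod_add)
  finally show ?thesis
    by simp
qed

text \<open>The subsets of \<open>A\<close> that miss \<open>T\<close> are the subsets of
  \<open>A - T\<close>.\<close>

lemma sum_power_card_Pow_meeting:
  fixes t :: "'a::comm_ring_1"
  assumes "finite A"
  shows "(\<Sum>S\<in>Pow A. t ^ card S * (if S \<inter> T \<noteq> {} then 1 else 0)) =
    (1 + t) ^ card A - (1 + t) ^ card (A - T)"
proof -
  have "(\<Sum>S\<in>Pow A. t ^ card S * (if S \<inter> T \<noteq> {} then 1 else 0)) =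
      (\<Sum>S\<in>Pow A. t ^ card S) - (\<Sum>S\<in>Pow A. if S \<inter> T = {} then t ^ card S else 0)"
    unfolding sum_subtractf[symmetric] by (rule sum.cong) auto
  also have "(\<Sum>S\<in>Pow A. if S \<inter> T = {} then t ^ card S else 0) =
      (\<Sum>S\<in>{S \<in> Pow A. S \<inter> T = {}}. t ^ card S)"
    using assms by (subst sum.inter_filter) auto
  also have "{S \<in> Pow A. S \<inter> T = {}} = Pow (A - T)"
    by auto
  finally show ?thesis
    using assms by (simp add: sum_power_card_Pow)
qed

text \<open>Subtracting \<open>b\<close> letter by letter is a bijection. The words on the right may
  have letters 0, so their number depends on \<open>b\<close> only through its sum.\<close>

lemma card_lists_bounded_below:
  "card {w. length w = n \<and> sum_list w = m \<and> (\<forall>i<n. b i \<le> w ! i)} =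
    (if (\<Sum>i<n. b i) \<le> m then card {w :: nat list. length w = n \<and> sum_list w = m - (\<Sum>i<n. b i)}
     else 0)"
    (is "card ?A = (if ?s \<le> m then card ?B else 0)")
proof (cases "?s \<le> m")
  case True
  have "bij_betw (\<lambda>w. map (\<lambda>i. w ! i - b i) [0..<n]) ?A ?B"
  proof (rule bij_betw_byWitness[where f' = "\<lambda>w. map (\<lambda>i. w ! i + b i) [0..<n]"])
    show "(\<lambda>w. map (\<lambda>i. w ! i - b i) [0..<n]) ` ?A \<subseteq> ?B"
      by (auto simp: sum_list_sum_nth atLeast0LessThan intro!: sum_subtractf_nat)
    show "(\<lambda>w. map (\<lambda>i. w ! i + b i) [0..<n]) ` ?B \<subseteq> ?A"
      using True by (auto simp: sum_list_sum_nth atLeast0LessThan sum.distrib)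
  qed (auto intro: nth_equalityI)
  with True show ?thesis
    by (simp add: bij_betw_same_card)
next
  case False
  have "?A = {}"
  proof -
    have "?s \<le> m" if "length w = n" "sum_list w = m" "\<forall>i<n. b i \<le> w ! i" for w
      using that by (auto simp: sum_list_sum_nth atLeast0LessThan intro!: sum_mono)
    with False show ?thesis by blast
  qed
  with False show ?thesis
    by (metis card.empty)
qed

section \<open>Sets of occurrences and the least words containing them\<close>

definition positions :: "nat list \<Rightarrow> nat \<Rightarrow> nat set" where
  "positions u n = {j. j + length u \<le> n}"

text \<open>The exponent e(i,k) of the overview is
  \<open>card (positions u n - covering u i k)\<close>.\<close>

definition covering :: "nat list \<Rightarrow> nat \<Rightarrow> nat \<Rightarrow> nat set" where
  "covering u i k = {s. s \<le> i \<and> i < s + length u \<and> k < u ! (i - s)}"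

text \<open>Letter \<open>i\<close> of the pointwise least positive word with \<open>u\<close> at
  all positions in \<open>S\<close>. The inserted 1 is the bound for positive letters and also the
  value on columns that no copy of \<open>u\<close> reaches.\<close>

definition least_letter :: "nat list \<Rightarrow> nat set \<Rightarrow> nat \<Rightarrow> nat" where
  "least_letter u S i = Max (insert 1 ((\<lambda>s. u ! (i - s)) ` {s \<in> S. s \<le> i \<and> i < s + length u}))"

definition occurrences :: "nat list \<Rightarrow> nat list \<Rightarrow> nat set" where
  "occurrences u w = {j. j + length u \<le> length w \<and> (\<forall>i<length u. u ! i \<le> w ! (j + i))}"

lemma finite_positions: "finite (positions u n)"
  by (rule finite_subset[of _ "{..n}"]) (auto simp: positions_def)

lemma occurrences_subset: "occurrences u w \<subseteq> positions u (length w)"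
  by (auto simp: occurrences_def positions_def)

lemma num_dominating_eq: "num_dominating u w = card (occurrences u w)"
  unfolding num_dominating_def occurrences_def dominates_def
  by (rule arg_cong[where f = card]) (auto simp: add.commute)

lemma least_letter_le_iff:
  "least_letter u S i \<le> a \<longleftrightarrow>
    1 \<le> a \<and> (\<forall>s\<in>S. s \<le> i \<and> i < s + length u \<longrightarrow> u ! (i - s) \<le> a)"
proof -
  have "finite {s \<in> S. s \<le> i \<and> i < s + length u}"
    by (rule finite_subset[of _ "{..i}"]) auto
  then show ?thesis
    unfolding least_letter_def by (subst Max_le_iff) auto
qed

lemma subset_occurrences_iff:
  assumes "S \<subseteq> positions u n"
  shows "w \<in> pos_words \<and> length w = n \<and> S \<subseteq> occurrences u w \<longleftrightarrow>
    length w = n \<and> (\<forall>i<n. least_letter u S i \<le> w ! i)"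
proof (intro iffI; elim conjE)
  assume w: "w \<in> pos_words" "length w = n" "S \<subseteq> occurrences u w"
  have "least_letter u S i \<le> w ! i" if "i < n" for i
    unfolding least_letter_le_iff
  proof (intro conjI ballI impI)
    show "1 \<le> w ! i"
      using w that nth_mem[of i w] by (auto simp: pos_words_def in_lists_conv_set)
  next
    fix s
    assume "s \<in> S" "s \<le> i \<and> i < s + length u"
    then show "u ! (i - s) \<le> w ! i"
      using w(3) by (auto simp: occurrences_def dest!: subsetD spec[of _ "i - s"])
  qed
  with w show "length w = n \<and> (\<forall>i<n. least_letter u S i \<le> w ! i)"
    by blast
next
  assume w: "length w = n" "\<forall>i<n. least_letter u S i \<le> w ! i"
  then have "w \<in> pos_words"
    by (auto simp: pos_words_def in_lists_conv_set in_set_conv_nth least_letter_le_iff)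
  moreover have "s \<in> occurrences u w" if "s \<in> S" for s
  proof -
    have s: "s + length u \<le> n"
      using that assms by (auto simp: positions_def)
    have "u ! i \<le> w ! (s + i)" if "i < length u" for i
      using w(2)[rule_format, of "s + i"] s that \<open>s \<in> S\<close>
      by (auto simp: least_letter_le_iff dest!: bspec[of _ _ s])
    with s w(1) show ?thesis
      by (simp add: occurrences_def)
  qed
  ultimately show "w \<in> pos_words \<and> length w = n \<and> S \<subseteq> occurrences u w"
    using w(1) by blast
qed

section \<open>Factoring out the words over the naturals and extracting weights\<close>

text \<open>The \<open>fps_X\<close> inside \<open>fps_const\<close> is z, so that
  \<open>fps_X - 1\<close> is t; the other \<open>fps_X\<close> is y. Only the first factor depends
  on \<open>u\<close>.\<close>

lemma word_gf_nth_factor: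
  "fps_nth (word_gf u) n =
    (\<Sum>S\<in>Pow (positions u n).
        fps_const ((fps_X - 1) ^ card S) * fps_X ^ (\<Sum>i<n. least_letter u S i)) *
    Abs_fps (\<lambda>m. of_nat (card {w :: nat list. length w = n \<and> sum_list w = m}))"
    (is "_ = ?Q * ?F")
proof (rule fps_ext)
  fix m
  let ?P = "positions u n" and ?t = "fps_X - 1 :: int fps"
  let ?W = "{w \<in> pos_words. length w = n \<and> sum_list w = m}"
  let ?\<sigma> = "\<lambda>S. \<Sum>i<n. least_letter u S i"
  have "fps_nth (fps_nth (word_gf u) n) m = (\<Sum>w\<in>?W. fps_X ^ card (occurrences u w))"
    by (simp add: word_gf_def num_dominating_eq)
  also have "\<dots> = (\<Sum>w\<in>?W. \<Sum>S\<in>Pow ?P. if S \<subseteq> occurrences u w then ?t ^ card S else 0)"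
  proof (rule sum.cong[OF refl])
    fix w
    assume "w \<in> ?W"
    then have sub: "occurrences u w \<subseteq> ?P"
      using occurrences_subset[of u w] by simp
    have "fps_X ^ card (occurrences u w) = (\<Sum>S\<in>Pow (occurrences u w). ?t ^ card S)"
      using sum_power_card_Pow[OF finite_subset[OF sub finite_positions], of ?t] by simp
    also have "Pow (occurrences u w) = {S \<in> Pow ?P. S \<subseteq> occurrences u w}"
      using sub by blast
    also have "(\<Sum>S\<in>\<dots>. ?t ^ card S) =
        (\<Sum>S\<in>Pow ?P. if S \<subseteq> occurrences u w then ?t ^ card S else 0)"
      by (rule sum.inter_filter) (simp add: finite_positions)
    finally show "fps_X ^ card (occurrences u w) = \<dots>" .
  qed
  also have "\<dots> = (\<Sum>S\<in>Pow ?P. \<Sum>w\<in>?W. if S \<subseteq> occurrences u w then ?t ^ card S else 0)"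
    by (rule sum.swap)
  also have "\<dots> = (\<Sum>S\<in>Pow ?P. fps_nth (fps_const (?t ^ card S) * fps_X ^ ?\<sigma> S * ?F) m)"
  proof (rule sum.cong[OF refl])
    fix S
    assume "S \<in> Pow ?P"
    then have S: "{w \<in> ?W. S \<subseteq> occurrences u w} =
        {w. length w = n \<and> sum_list w = m \<and> (\<forall>i<n. least_letter u S i \<le> w ! i)}"
      using subset_occurrences_iff[of S u n] by blast
    have "(\<Sum>w\<in>?W. if S \<subseteq> occurrences u w then ?t ^ card S else 0) =
        (\<Sum>w\<in>{w \<in> ?W. S \<subseteq> occurrences u w}. ?t ^ card S)"
      by (rule sum.inter_filter[symmetric]) (rule finite_pos_words)
    also have "\<dots> = ?t ^ card S * of_nat (card
        {w. length w = n \<and> sum_list w = m \<and> (\<forall>i<n. least_letter u S i \<le> w ! i)})"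
      unfolding S by simp
    also have "\<dots> = fps_nth (fps_const (?t ^ card S) * (fps_X ^ ?\<sigma> S * ?F)) m"
      unfolding card_lists_bounded_below fps_mult_left_const_nth fps_X_power_mult_nth
      by auto
    finally show "(\<Sum>w\<in>?W. if S \<subseteq> occurrences u w then ?t ^ card S else 0) =
        fps_nth (fps_const (?t ^ card S) * fps_X ^ ?\<sigma> S * ?F) m"
      by (simp only: mult.assoc)
  qed
  also have "\<dots> = fps_nth (?Q * ?F) m"
    by (simp only: sum_distrib_right fps_sum_nth)
  finally show "fps_nth (fps_nth (word_gf u) n) m = fps_nth (?Q * ?F) m" .
qed

text \<open>Both sides are the derivative at y = 1 of a polynomial in y; the bound \<open>B\<close>
  on its exponents turns the evaluation into a finite sum.\<close>

lemma weighted_sum_fps_nth: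
  fixes c :: "'b \<Rightarrow> 'a::comm_ring_1"
  assumes "\<And>x. x \<in> I \<Longrightarrow> e x \<le> B"
  shows "(\<Sum>m\<le>B. of_nat m * fps_nth (\<Sum>x\<in>I. fps_const (c x) * fps_X ^ e x) m) =
    (\<Sum>x\<in>I. c x * of_nat (e x))"
proof -
  have "(\<Sum>m\<le>B. of_nat m * fps_nth (\<Sum>x\<in>I. fps_const (c x) * fps_X ^ e x) m) =
      (\<Sum>m\<le>B. \<Sum>x\<in>I. of_nat m * (c x * (if m = e x then 1 else 0)))"
    by (simp only: fps_sum_nth fps_mult_left_const_nth fps_X_power_nth sum_distrib_left)
  also have "\<dots> = (\<Sum>x\<in>I. \<Sum>m\<le>B. of_nat m * (c x * (if m = e x then 1 else 0)))"
    by (rule sum.swap)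
  also have "\<dots> = (\<Sum>x\<in>I. c x * of_nat (e x))"
  proof (rule sum.cong[OF refl])
    fix x
    assume "x \<in> I"
    have "(\<Sum>m\<le>B. of_nat m * (c x * (if m = e x then 1 else 0))) =
        (\<Sum>m\<le>B. if m = e x then of_nat m * c x else 0)"
      by (rule sum.cong) auto
    also have "\<dots> = c x * of_nat (e x)"
      using assms[OF \<open>x \<in> I\<close>] by (simp add: mult.commute)
    finally show "(\<Sum>m\<le>B. of_nat m * (c x * (if m = e x then 1 else 0))) = c x * of_nat (e x)" .
  qed
  finally show ?thesis .
qed

lemma sum_least_letter_eq:
  assumes "strongly_wilf_equivalent u v"
  shows "(\<Sum>S\<in>Pow (positions u n). (fps_X - 1 :: int fps) ^ card S * of_nat (\<Sum>i<n. least_letter u S i)) =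
    (\<Sum>S\<in>Pow (positions v n). (fps_X - 1) ^ card S * of_nat (\<Sum>i<n. least_letter v S i))"
proof -
  let ?\<sigma> = "\<lambda>u S. \<Sum>i<n. least_letter u S i"
  define Q where "Q u = (\<Sum>S\<in>Pow (positions u n).
    fps_const ((fps_X - 1 :: int fps) ^ card S) * fps_X ^ ?\<sigma> u S)" for u
  define F where
    "F = Abs_fps (\<lambda>m. of_nat (card {w :: nat list. length w = n \<and> sum_list w = m}) :: int fps)"
  \<comment> \<open>The constant coefficient of \<open>F\<close> is 1, so \<open>F\<close> can be
    cancelled in the integral domain of power series.\<close>
  have "{w :: nat list. length w = n \<and> sum_list w = 0} = {replicate n 0}"
    by (auto simp: sum_list_eq_0_iff intro: replicate_eqI)
  then have "fps_nth F 0 = 1"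
    by (simp add: F_def)
  then have "F \<noteq> 0"
    by auto
  moreover have "Q u * F = Q v * F"
    using assms unfolding strongly_wilf_equivalent_def Q_def F_def
    by (simp only: word_gf_nth_factor[symmetric])
  ultimately have eq: "Q u = Q v"
    by simp
  \<comment> \<open>Any common bound on the weights serves; the sum of all of them is one.\<close>
  define B where "B = (\<Sum>S\<in>Pow (positions u n). ?\<sigma> u S) + (\<Sum>S\<in>Pow (positions v n). ?\<sigma> v S)"
  have "?\<sigma> x S \<le> (\<Sum>S\<in>Pow (positions x n). ?\<sigma> x S)" if "S \<in> Pow (positions x n)" for x S
    using that by (intro member_le_sum) (auto simp: finite_positions)
  then have B: "S \<in> Pow (positions u n) \<Longrightarrow> ?\<sigma> u S \<le> B" "S \<in> Pow (positions v n) \<Longrightarrow> ?\<sigma> v S \<le> B" for S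
    unfolding B_def by (simp_all add: trans_le_add1 trans_le_add2)
  show ?thesis
    using weighted_sum_fps_nth[of "Pow (positions u n)" "?\<sigma> u" B "\<lambda>S. (fps_X - 1 :: int fps) ^ card S"]
      weighted_sum_fps_nth[of "Pow (positions v n)" "?\<sigma> v" B "\<lambda>S. (fps_X - 1 :: int fps) ^ card S"]
      B eq
    unfolding Q_def by (simp only:)
qed

section \<open>Splitting the weight into columns and levels\<close>

text \<open>A positive integer m is 1 plus the number of levels k with 1 \<le> k < m, and column
  \<open>i\<close> rises above level \<open>k\<close> exactly when some position in \<open>S\<close>
  puts a letter greater than \<open>k\<close> there.\<close>

lemma least_letter_eq_sum:
  assumes "set u \<subseteq> {..K}"
  shows "least_letter u S i = 1 + (\<Sum>k\<in>{1..<K}. if S \<inter> covering u i k \<noteq> {} then 1 else 0)"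
proof -
  define A where "A = (\<lambda>s. u ! (i - s)) ` {s \<in> S. s \<le> i \<and> i < s + length u}"
  have fin: "finite A"
    unfolding A_def by (rule finite_imageI, rule finite_subset[of _ "{..i}"]) auto
  have "A \<subseteq> {..K}"
    using assms unfolding A_def by (auto dest!: subsetD intro: nth_mem)
  then have "k < K" if "a \<in> A" "k < a" for a k
    using that by fastforce
  moreover have "S \<inter> covering u i k \<noteq> {} \<longleftrightarrow> (\<exists>a\<in>A. k < a)" for k
    unfolding A_def covering_def by auto
  ultimately have "{k \<in> {1..<K}. S \<inter> covering u i k \<noteq> {}} = {1..<Max (insert 1 A)}"
    using fin by (auto simp: Max_gr_iff)
  then have "(\<Sum>k\<in>{1..<K}. if S \<inter> covering u i k \<noteq> {} then 1 else 0) = Max (insert 1 A) - 1"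
    by (subst sum.inter_filter[symmetric]) simp_all
  moreover have "1 \<le> Max (insert 1 A)"
    using fin by simp
  ultimately show ?thesis
    unfolding least_letter_def A_def[symmetric] by simp
qed

text \<open>Exchanging sums leaves, for each column and level, the subsets that meet a fixed set.
  Only the last power involves more of \<open>u\<close> than its length.\<close>

lemma sum_least_letter:
  fixes t :: "'a::comm_ring_1"
  assumes "set u \<subseteq> {..K}"
  shows "(\<Sum>S\<in>Pow (positions u n). t ^ card S * of_nat (\<Sum>i<n. least_letter u S i)) =
    of_nat n * (1 + t) ^ card (positions u n) +
    (\<Sum>i<n. \<Sum>k\<in>{1..<K}. (1 + t) ^ card (positions u n) - (1 + t) ^ card (positions u n - covering u i k))"
proof -
  let ?P = "positions u n"
  let ?b = "\<lambda>S i k. if S \<inter> covering u i k \<noteq> {} then 1 else 0 :: 'a"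
  have "t ^ card S * of_nat (\<Sum>i<n. least_letter u S i) =
      of_nat n * t ^ card S + (\<Sum>i<n. \<Sum>k\<in>{1..<K}. t ^ card S * ?b S i k)" for S
  proof -
    have "of_nat (\<Sum>i<n. least_letter u S i) = (of_nat n + (\<Sum>i<n. \<Sum>k\<in>{1..<K}. ?b S i k))"
      by (simp add: least_letter_eq_sum[OF assms] sum.distrib of_nat_sum if_distrib cong: if_cong)
    then show ?thesis
      by (simp only: distrib_left sum_distrib_left mult.commute)
  qed
  then have "(\<Sum>S\<in>Pow ?P. t ^ card S * of_nat (\<Sum>i<n. least_letter u S i)) =
      of_nat n * (\<Sum>S\<in>Pow ?P. t ^ card S) +
      (\<Sum>S\<in>Pow ?P. \<Sum>i<n. \<Sum>k\<in>{1..<K}. t ^ card S * ?b S i k)"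
    by (simp only: sum.distrib sum_distrib_left)
  also have "(\<Sum>S\<in>Pow ?P. \<Sum>i<n. \<Sum>k\<in>{1..<K}. t ^ card S * ?b S i k) =
      (\<Sum>i<n. \<Sum>S\<in>Pow ?P. \<Sum>k\<in>{1..<K}. t ^ card S * ?b S i k)"
    by (rule sum.swap)
  also have "\<dots> = (\<Sum>i<n. \<Sum>k\<in>{1..<K}. \<Sum>S\<in>Pow ?P. t ^ card S * ?b S i k)"
    by (intro sum.cong refl sum.swap)
  finally show ?thesis
    by (simp only: sum_power_card_Pow_meeting[OF finite_positions] sum_power_card_Pow[OF finite_positions])
qed

section \<open>Columns at two consecutive lengths\<close>

text \<open>The new position \<open>l\<close> starts to the right of column
  \<open>i\<close>.\<close>

lemma card_Diff_covering_low:
  assumes "i < l"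
  shows "card ({..l} - covering u i k) = Suc (card ({..<l} - covering u i k))"
proof -
  have "{..l} - covering u i k = insert l ({..<l} - covering u i k)"
    using assms by (auto simp: covering_def)
  then show ?thesis
    by simp
qed

text \<open>Shifting positions and column by one preserves covering, and a copy at the new position
  0 ends before column \<open>Suc i\<close>.\<close>

lemma card_Diff_covering_high:
  assumes "length u \<le> Suc i"
  shows "card ({..l} - covering u (Suc i) k) = Suc (card ({..<l} - covering u i k))"
proof -
  have "{..l} - covering u (Suc i) k = insert 0 (Suc ` ({..<l} - covering u i k))" (is "?A = ?B")
  proof (rule set_eqI)
    show "s \<in> ?A \<longleftrightarrow> s \<in> ?B" for s
      using assms by (cases s) (auto simp: covering_def)
  qed
  then show ?thesis
    by (simp add: card_image)
qed

text \<open>The positions from 1 to \<open>length u\<close> align each letter of \<open>u\<close>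
  once with this column; the copy at 0 ends just before it and accounts for the
  \<open>Suc\<close>.\<close>

lemma card_Diff_covering_middle:
  "card ({..length u} - covering u (length u) k) = Suc (length (filter (\<lambda>a. a \<le> k) u))"
proof -
  let ?I = "{i. i < length u \<and> u ! i \<le> k}"
  have "{..length u} - covering u (length u) k = insert 0 ((\<lambda>i. length u - i) ` ?I)" (is "?A = ?B")
  proof (rule set_eqI)
    fix s
    show "s \<in> ?A \<longleftrightarrow> s \<in> ?B"
    proof
      assume "s \<in> ?A"
      moreover have "s = length u - (length u - s)" if "s \<le> length u"
        using that by simp
      ultimately show "s \<in> ?B"
        by (cases "s = 0") (auto simp: covering_def intro!: image_eqI[of s _ "length u - s"])
    qed (auto simp: covering_def)
  qed
  moreover have "inj_on (\<lambda>i. length u - i) ?I"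
    by (auto simp: inj_on_def)
  moreover have "0 \<notin> (\<lambda>i. length u - i) ` ?I" "finite ?I"
    by auto
  ultimately show ?thesis
    by (simp add: card_image length_filter_conv_card)
qed

lemma positions_double:
  "positions u (2 * length u) = {..length u}"
  "u \<noteq> [] \<Longrightarrow> positions u (2 * length u - 1) = {..<length u}"
  unfolding positions_def by (auto simp flip: length_greater_0_conv)

text \<open>Lengthening the ambient word from \<open>2 * length u - 1\<close> to \<open>2 * length u\<close> adds the column \<open>length u\<close>,
  to which every letter of \<open>u\<close> can be aligned; each other column only gains one position that does not
  cover it.\<close>

lemma sum_covering_step:
  fixes z :: "'a::comm_ring_1"
  assumes "u \<noteq> []"
  shows "(\<Sum>i<2 * length u. \<Sum>k\<in>J. z ^ card ({..length u} - covering u i k)) =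
    z * (\<Sum>i<2 * length u - 1. \<Sum>k\<in>J. z ^ card ({..<length u} - covering u i k)) +
    (\<Sum>k\<in>J. z ^ Suc (length (filter (\<lambda>a. a \<le> k) u)))"
proof -
  let ?l = "length u"
  let ?f = "\<lambda>i. \<Sum>k\<in>J. z ^ card ({..?l} - covering u i k)"
  let ?g = "\<lambda>i. \<Sum>k\<in>J. z ^ card ({..<?l} - covering u i k)"
  have l: "0 < ?l"
    using assms by simp
  \<comment> \<open>Columns left of \<open>?l\<close> match the same columns of the shorter word,
    those right of \<open>?l\<close> match their left neighbours.\<close>
  have "{..<2 * ?l} = {..<?l} \<union> insert ?l (Suc ` {?l..<2 * ?l - 1})"
    using l by auto
  then have "sum ?f {..<2 * ?l} = sum ?f {..<?l} + (?f ?l + sum ?f (Suc ` {?l..<2 * ?l - 1}))"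
    by (simp add: sum.union_disjoint disjoint_iff image_iff del: image_Suc_atLeastLessThan Un_insert_right)
  also have "sum ?f {..<?l} = z * sum ?g {..<?l}"
    by (simp add: card_Diff_covering_low sum_distrib_left)
  also have "sum ?f (Suc ` {?l..<2 * ?l - 1}) = z * sum ?g {?l..<2 * ?l - 1}"
    by (simp add: sum.reindex card_Diff_covering_high sum_distrib_left del: image_Suc_atLeastLessThan)
  also have "z * sum ?g {..<?l} + (?f ?l + z * sum ?g {?l..<2 * ?l - 1}) =
      z * (sum ?g {..<?l} + sum ?g {?l..<2 * ?l - 1}) + ?f ?l"
    by (simp add: algebra_simps)
  also have "sum ?g {..<?l} + sum ?g {?l..<2 * ?l - 1} = sum ?g {..<2 * ?l - 1}"
    using l sum.atLeastLessThan_concat[of 0 ?l "2 * ?l - 1" ?g] by (simp add: atLeast0LessThan)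
  finally show ?thesis
    by (simp only: card_Diff_covering_middle)
qed

section \<open>Recovering the length and the letters\<close>

text \<open>The coefficients give the values of \<open>f\<close> and \<open>g\<close> with
  multiplicity. By monotonicity both lists of values are sorted, and a sorted list is determined by
  its multiset.\<close>

lemma eq_on_if_sum_fps_X_power_eq:
  fixes f g :: "nat \<Rightarrow> nat"
  assumes "mono f" "mono g"
    and "(\<Sum>k\<in>{a..<b}. fps_X ^ f k :: int fps) = (\<Sum>k\<in>{a..<b}. fps_X ^ g k)"
    and "k \<in> {a..<b}"
  shows "f k = g k"
proof -
  have count: "fps_nth (\<Sum>k\<in>{a..<b}. fps_X ^ f k :: int fps) c =
      int (count (mset (map f [a..<b])) c)" for f c
  proof -
    have "fps_nth (\<Sum>k\<in>{a..<b}. fps_X ^ f k :: int fps) c = int (card {k \<in> {a..<b}. f k = c})"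
      by (simp add: fps_sum_nth fps_X_power_nth sum.inter_filter[symmetric] eq_commute)
    also have "card {k \<in> {a..<b}. f k = c} = length (filter (\<lambda>k. f k = c) [a..<b])"
      by (subst distinct_card[symmetric]) auto
    also have "\<dots> = count (mset (map f [a..<b])) c"
      by (simp add: count_mset count_list_eq_length_filter filter_map comp_def eq_commute del: mset_map mset_upt)
    finally show ?thesis .
  qed
  have "mset (map f [a..<b]) = mset (map g [a..<b])"
    by (rule multiset_eqI) (metis count assms(3) of_nat_eq_iff)
  moreover have "sorted (map f [a..<b])" "sorted (map g [a..<b])"
    using assms(1,2) by (auto simp: sorted_map mono_def sorted_wrt_iff_nth_less)
  ultimately have "map f [a..<b] = map g [a..<b]"
    by (metis properties_for_sort)
  with assms(4) show ?thesis
    by (simp add: map_eq_conv)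
qed

text \<open>The word \<open>u\<close> occurs in itself, so its own monomial has a nonzero
  coefficient with positive z-exponent. The same coefficient for \<open>v\<close> yields a word of
  length \<open>length u\<close> in which \<open>v\<close> occurs.\<close>

lemma strongly_wilf_equivalent_length_le:
  assumes "u \<in> pos_words" "strongly_wilf_equivalent u v"
  shows "length v \<le> length u"
proof -
  let ?C = "\<lambda>x. {w \<in> pos_words. length w = length u \<and> sum_list w = sum_list u \<and>
    num_dominating x w = num_dominating u u}"
  have fin: "finite (?C x)" for x
    by (rule finite_subset[OF _ finite_pos_words]) auto
  have "u \<in> ?C u"
    using assms(1) by simp
  then have "card (?C u) \<noteq> 0"
    using card_0_eq[OF fin] by blast
  moreover have "int (card (?C u)) = int (card (?C v))"
    using assms(2) unfolding word_gf_nth[symmetric] strongly_wilf_equivalent_def by simp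
  ultimately have "card (?C v) \<noteq> 0"
    by linarith
  then have "?C v \<noteq> {}"
    by (metis card.empty)
  then obtain w where w: "length w = length u" "num_dominating v w = num_dominating u u"
    by blast
  have "0 \<in> occurrences u u" "finite (occurrences u u)"
    using finite_subset[OF occurrences_subset finite_positions] by (auto simp: occurrences_def)
  then have "num_dominating u u \<noteq> 0"
    by (auto simp: num_dominating_eq)
  then obtain j where "j \<in> occurrences v w"
    using w(2) by (metis card.empty ex_in_conv num_dominating_eq)
  then show ?thesis
    using w(1) by (simp add: occurrences_def)
qed

lemma length_filter_le_eq_imp_mset_eq:
  fixes u v :: "nat list"
  assumes "\<And>k. length (filter (\<lambda>a. a \<le> k) u) = length (filter (\<lambda>a. a \<le> k) v)"
  shows "mset u = mset v"
proof (rule multiset_eqI)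
  have *: "length (filter (\<lambda>b. b \<le> Suc a) x) = length (filter (\<lambda>b. b \<le> a) x) + count (mset x) (Suc a)"
    for x :: "nat list" and a
    by (induction x) (auto simp: le_Suc_eq)
  have **: "length (filter (\<lambda>b. b \<le> 0) x) = count (mset x) 0" for x :: "nat list"
    by (induction x) auto
  show "count (mset u) a = count (mset v) a" for a
  proof (cases a)
    case 0
    show ?thesis
      unfolding 0 **[symmetric] by (rule assms)
  next
    case (Suc b)
    show ?thesis
      using *[of b u] *[of b v] assms[of b] assms[of a] Suc by simp
  qed
qed

theorem theorem1:
  fixes u v :: "nat list"
  assumes "u \<in> pos_words" and "v \<in> pos_words"
    and "strongly_wilf_equivalent u v"
  shows "length u = length v \<and>
    (\<exists>\<pi>. \<pi> permutes {..<length u} \<and> v = permute_list \<pi> u)"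
proof -
  have "strongly_wilf_equivalent v u"
    using assms(3) by (simp add: strongly_wilf_equivalent_def)
  then have len: "length u = length v"
    using strongly_wilf_equivalent_length_le assms by (metis order.antisym)
  have "mset v = mset u"
  proof (cases "u = []")
    case True
    then show ?thesis
      using len by simp
  next
    case False
    then have "v \<noteq> []"
      using len by auto
    define K where "K = Max (set u \<union> set v)"
    have K: "set u \<subseteq> {..K}" "set v \<subseteq> {..K}"
      by (auto simp: K_def)
    have pos: "positions v n = positions u n" for n
      by (simp add: positions_def len)
    \<comment> \<open>Here 1 + t is \<open>fps_X\<close>, and the terms that depend only on
      \<open>n\<close>, \<open>K\<close> and the common length cancel.\<close>
    have E: "(\<Sum>i<n. \<Sum>k\<in>{1..<K}. (fps_X :: int fps) ^ card (positions u n - covering u i k)) =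
        (\<Sum>i<n. \<Sum>k\<in>{1..<K}. fps_X ^ card (positions u n - covering v i k))" for n
      using sum_least_letter_eq[OF assms(3), of n]
      unfolding sum_least_letter[OF K(1)] sum_least_letter[OF K(2)]
      by (simp add: sum_subtractf pos)
    let ?c = "\<lambda>x k. length (filter (\<lambda>a. a \<le> k) x)"
    \<comment> \<open>Subtracting z times the identity for the shorter length from that for the
      longer one leaves the middle column.\<close>
    have "(\<Sum>k\<in>{1..<K}. (fps_X :: int fps) ^ Suc (?c u k)) = (\<Sum>k\<in>{1..<K}. fps_X ^ Suc (?c v k))"
      using E[of "2 * length u", unfolded positions_double(1)]
        E[of "2 * length u - 1", unfolded positions_double(2)[OF False]]
        sum_covering_step[OF False, of "fps_X :: int fps" "{1..<K}"]
        sum_covering_step[OF \<open>v \<noteq> []\<close>, of "fps_X :: int fps" "{1..<K}", unfolded len[symmetric]]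
      by (simp only: add_left_cancel)
    moreover have "mono (\<lambda>k. Suc (?c x k))" for x :: "nat list"
      by (rule monoI, induction x) (auto intro: le_SucI)
    ultimately have mid: "?c u k = ?c v k" if "k \<in> {1..<K}" for k
      using eq_on_if_sum_fps_X_power_eq[of "\<lambda>k. Suc (?c u k)" "\<lambda>k. Suc (?c v k)" 1 K k] that by simp
    \<comment> \<open>Outside the levels compared so far the counts are forced: no letter is at most
      0, and all letters are at most \<open>K\<close>.\<close>
    have "?c u k = ?c v k" for k
    proof -
      consider "k = 0" | "k \<in> {1..<K}" | "K \<le> k"
        by fastforce
      then show ?thesis
      proof cases
        case 1
        have "?c x 0 = 0" if "x \<in> pos_words" for x
          using that by (auto simp: pos_words_def in_lists_conv_set filter_empty_conv)
        with 1 assms show ?thesis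
          by simp
      next
        case 2
        then show ?thesis
          by (rule mid)
      next
        case 3
        then have "filter (\<lambda>a. a \<le> k) u = u" "filter (\<lambda>a. a \<le> k) v = v"
          using K by (auto simp: filter_id_conv intro: order.trans)
        with len show ?thesis
          by simp
      qed
    qed
    then show ?thesis
      by (intro length_filter_le_eq_imp_mset_eq) simp
  qed
  then show ?thesis
    using len by (metis mset_eq_permutation)
qed

end
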